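(* Let $k$ be a field of characteristic zero, $S=k[x,y,z]$, and let $I=(x^a,y^b,z^c,x^{\alpha}z^{\gamma},y^{\beta}z^{\gamma})$ where $a,b,c,\alpha,\beta,\gamma$ are integers with $0<\alpha<a$, $0<\beta<b$ and $0<\gamma<c$. Then $S/I$ has the strong Lefschetz property if any of the following conditions holds: (1) $\alpha+\beta-1\le a+b-c\le\alpha+\beta+1$; (2) $\min\{\alpha,\beta\}\ne\max\{\alpha,\beta\}=\min\{\alpha+\beta,a,b\}$ and $\max\{\alpha,\beta\}-\gamma-1\le a+b-c\le\max\{\alpha,\beta\}-\gamma+1$; (3) $\min\{\alpha,\beta\}<\max\{\alpha,\beta\}\le 2$ and $a+b+\gamma\le c+2$.
   Context: $S$ is standard graded. A graded Artinian $k$-algebra $A=S/I$ has the strong Lefschetz property if there exists a linear form $\ell\in A_1$ such that the multiplication map $\times\ell^d\colon A_i\to A_{i+d}$ has maximal rank (is injective or surjective) for all $d>0$ and all $i$. *)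

theory Defs
  imports "HOL-Library.Poly_Mapping" "HOL-Library.Product_Plus"
begin

text \<open>Polynomial ring S = k[x,y,z]: finitely supported maps from exponent triples
  (i,j,l) (standing for x^i y^j z^l) to coefficients in k.\<close>
type_synonym 'k poly3 = "(nat \<times> nat \<times> nat) \<Rightarrow>\<^sub>0 'k"

definition mon :: "nat \<Rightarrow> nat \<Rightarrow> nat \<Rightarrow> 'k::comm_ring_1 poly3" where
  "mon i j l = Poly_Mapping.single (i, j, l) 1"

definition tdeg :: "nat \<times> nat \<times> nat \<Rightarrow> nat" where
  "tdeg m = (case m of (i, j, l) \<Rightarrow> i + j + l)"

text \<open>f is homogeneous of degree d, i.e. f lies in S_d (the zero polynomial lies in every S_d).\<close>
definition homog :: "nat \<Rightarrow> 'k::zero poly3 \<Rightarrow> bool" where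
  "homog d f \<longleftrightarrow> (\<forall>m\<in>Poly_Mapping.keys f. tdeg m = d)"

definition gen_ideal :: "'a::comm_ring_1 set \<Rightarrow> 'a set" where
  "gen_ideal G = {f. \<exists>G' h. finite G' \<and> G' \<subseteq> G \<and> f = (\<Sum>g\<in>G'. h g * g)}"

text \<open>Strong Lefschetz property of A = S/I for a homogeneous ideal I, stated through
  representatives: A_i = S_i / I_i, a linear form of A is the class of some
  l in S_1, and multiplication by l^d : A_i \<rightarrow> A_{i+d} is injective resp. surjective.\<close>
definition SLP :: "'k::field poly3 set \<Rightarrow> bool" where
  "SLP I \<longleftrightarrow> (\<exists>l. homog 1 l \<and>
     (\<forall>d>0. \<forall>i.
        (\<forall>f. homog i f \<and> l ^ d * f \<in> I \<longrightarrow> f \<in> I)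
      \<or> (\<forall>g. homog (i + d) g \<longrightarrow> (\<exists>f. homog i f \<and> g - l ^ d * f \<in> I))))"

end

theory Submission
  imports Defs "HOL-Library.Function_Algebras" "HOL.Vector_Spaces"
begin

text \<open>On the span of a box of monomials, multiplication by \<open>x + y + z\<close> (truncated to the box) is the
  raising operator of an sl2-representation. Hence \<open>(x + y + z)^d\<close> is injective from degree \<open>i\<close>
  to degree \<open>i + d\<close> if \<open>2 i + d \<le> s\<close> and surjective if \<open>2 i + d \<ge> s\<close>, where \<open>s\<close> is the sum of the
  least and the greatest degree in the box. The monomials outside \<open>I\<close> are cut into boxes that span
  successive quotients of a chain of monomial ideals. If the numbers \<open>s\<close> of these boxes
  differ by at most one, then for all \<open>i\<close> and \<open>d\<close> either every box gives an injective map or every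
  box gives a surjective one, and this passes to \<open>S/I\<close>. In case (1) two boxes suffice, separated
  at \<open>z^\<gamma>\<close>; in case (2) there are three, the corner \<open>\<alpha> \<times> \<beta> \<times> c\<close> and two side boxes of
  height \<open>\<gamma>\<close>. In case (3) the corner is so long that in the relevant degrees it has
  bijective maps, while the side part is controlled by its embedding into \<open>a \<times> b \<times> \<gamma>\<close> (injectivity)
  and by its two boxes (surjectivity), with thresholds that differ by one.\<close>

section \<open>Graded representations of sl2\<close>

text \<open>The third sl2 operator stays implicit: by \<open>F_E\<close>, the commutator of
  \<open>F\<close> and \<open>E\<close> is the scalar s - 2 i in degree i. \<open>F_V0\<close> and
  \<open>V_bounded\<close> start the ascending and the descending induction on the degree.\<close>

locale graded_sl2 = vector_space scale
  for scale :: "'k::field_char_0 \<Rightarrow> 'v::ab_group_add \<Rightarrow> 'v" (infixr "*s" 75) +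
  fixes V :: "nat \<Rightarrow> 'v set" and E F :: "'v \<Rightarrow> 'v" and s :: int and N :: nat
  assumes linear_E: "Vector_Spaces.linear scale scale E"
    and linear_F: "Vector_Spaces.linear scale scale F"
    and subspace_V: "subspace (V i)"
    and V_bounded: "N < i \<Longrightarrow> v \<in> V i \<Longrightarrow> v = 0"
    and E_V: "v \<in> V i \<Longrightarrow> E v \<in> V (Suc i)"
    and F_V: "v \<in> V (Suc i) \<Longrightarrow> F v \<in> V i"
    and F_V0: "v \<in> V 0 \<Longrightarrow> F v = 0"
    and F_E: "v \<in> V i \<Longrightarrow> F (E v) = E (F v) + of_int (s - 2 * int i) *s v"
begin

interpretation E: Vector_Spaces.linear scale scale E by (fact linear_E)
interpretation F: Vector_Spaces.linear scale scale F by (fact linear_F)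

lemma E_pow_V: "v \<in> V i \<Longrightarrow> (E ^^ d) v \<in> V (i + d)"
  by (induction d) (auto simp: E_V)

lemma E_pow_add: "(E ^^ d) (u + v) = (E ^^ d) u + (E ^^ d) v"
  by (induction d) (auto simp: E.add)

lemma E_pow_scale: "(E ^^ d) (r *s v) = r *s (E ^^ d) v"
  by (induction d) (auto simp: E.scale)

lemma E_pow_zero: "(E ^^ d) 0 = 0"
  by (induction d) (auto simp: E.zero)

text \<open>Moving \<open>F\<close> past the factors \<open>E\<close> one by one contributes s - 2
  (i + k) for k = 0, ..., d; these scalars sum to (d + 1) (s - 2 i - d).\<close>

lemma F_E_pow:
  assumes "v \<in> V i"
  shows "F ((E ^^ Suc d) v) =
    (E ^^ Suc d) (F v) + of_int ((int d + 1) * (s - 2 * int i - int d)) *s (E ^^ d) v"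
proof (induction d)
  case 0
  show ?case using F_E[OF assms] by simp
next
  case (Suc d)
  have "F ((E ^^ Suc (Suc d)) v) =
      E (F ((E ^^ Suc d) v)) + of_int (s - 2 * int (i + Suc d)) *s (E ^^ Suc d) v"
    using F_E[OF E_pow_V[OF assms, of "Suc d"]] by simp
  also have "\<dots> = (E ^^ Suc (Suc d)) (F v)
      + (of_int ((int d + 1) * (s - 2 * int i - int d)) *s (E ^^ Suc d) v
      + of_int (s - 2 * int (i + Suc d)) *s (E ^^ Suc d) v)"
    unfolding Suc.IH by (simp add: E.add E.scale add.assoc)
  also have "of_int ((int d + 1) * (s - 2 * int i - int d)) *s (E ^^ Suc d) v
      + of_int (s - 2 * int (i + Suc d)) *s (E ^^ Suc d) v
      = of_int ((int d + 1) * (s - 2 * int i - int d) + (s - 2 * int (i + Suc d)))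
        *s (E ^^ Suc d) v"
    by (simp only: of_int_add scale_left_distrib)
  also have "(int d + 1) * (s - 2 * int i - int d) + (s - 2 * int (i + Suc d))
      = (int (Suc d) + 1) * (s - 2 * int i - int (Suc d))"
    by (simp add: algebra_simps)
  finally show ?case .
qed

text \<open>Induction on the degree, then on \<open>d\<close>. \<open>F v\<close> lies one degree
  lower and is killed by a power of \<open>E\<close> one higher, so the bound persists and
  \<open>F v = 0\<close>. Then \<open>F_E_pow\<close>, whose scalar is nonzero, lowers the power
  that kills \<open>v\<close>.\<close>

lemma E_pow_inj:
  "v \<in> V i \<Longrightarrow> 2 * int i + int d \<le> s \<Longrightarrow> (E ^^ d) v = 0 \<Longrightarrow> v = 0"
proof (induction i arbitrary: v d)
  case 0
  then show ?case
  proof (induction d)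
    case (Suc d)
    have "of_int ((int d + 1) * (s - int d)) *s (E ^^ d) v = 0"
      using F_E_pow[OF Suc.prems(1), of d] Suc.prems(3) F_V0[OF Suc.prems(1)]
      by (simp add: E_pow_zero F.zero E.zero del: of_int_mult)
    moreover have "(int d + 1) * (s - int d) \<noteq> 0" using Suc.prems(2) by auto
    ultimately have "(E ^^ d) v = 0" by (metis of_int_eq_0_iff scale_eq_0_iff)
    then show ?case using Suc by simp
  qed simp
next
  case (Suc i)
  note outer = Suc.IH
  show ?case using Suc.prems
  proof (induction d)
    case (Suc d)
    let ?c = "(int d + 1) * (s - 2 * int (Suc i) - int d)"
    have c: "?c \<noteq> 0" using Suc.prems(2) by auto
    have eq: "(E ^^ Suc d) (F v) + of_int ?c *s (E ^^ d) v = 0"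
      using F_E_pow[OF Suc.prems(1), of d] unfolding Suc.prems(3) by (simp only: F.zero)
    \<comment> \<open>One more \<open>E\<close> kills the second term, since
      \<open>(E ^^ Suc d) v = 0\<close>.\<close>
    have "E ((E ^^ Suc d) (F v) + of_int ?c *s (E ^^ d) v) = E 0" unfolding eq by simp
    then have "(E ^^ Suc (Suc d)) (F v) + of_int ?c *s (E ^^ Suc d) v = 0"
      by (simp add: E.add E.scale E.zero del: of_int_mult)
    then have "(E ^^ Suc (Suc d)) (F v) = 0"
      unfolding Suc.prems(3) by simp
    then have "F v = 0"
      using outer[OF F_V[OF Suc.prems(1)], of "Suc (Suc d)"] Suc.prems(2) by auto
    then have "of_int ?c *s (E ^^ d) v = 0" using eq by (simp only: E_pow_zero add_0)
    then have "(E ^^ d) v = 0" using c by (metis of_int_eq_0_iff scale_eq_0_iff)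
    then show ?case using Suc by simp
  qed simp
qed

text \<open>Descending induction on the degree: as \<^term>\<open>E g\<close> is already known to be hit, one may
  assume \<^term>\<open>E g = 0\<close>, and then the commutator formula exhibits a preimage of \<^term>\<open>g\<close>.\<close>

lemma E_pow_surj:
  assumes "g \<in> V e" and "d \<le> e" and "s \<le> 2 * int e - int d"
  shows "\<exists>h\<in>V (e - d). (E ^^ d) h = g"
proof -
  \<comment> \<open>\<open>n\<close> bounds the distance from \<open>e\<close> to the degrees above
    \<open>N\<close>, where everything vanishes; passing from \<open>g\<close> to \<open>E g\<close>
    lowers it by one.\<close>
  have "\<exists>h\<in>V (e - d). (E ^^ d) h = g"
    if "N < e + n" "g \<in> V e" "d \<le> e" "s \<le> 2 * int e - int d" for n e d g
    using that
  proof (induction n arbitrary: e d g)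
    case 0
    then have "g = 0" using V_bounded by simp
    then show ?case using subspace_0[OF subspace_V] E_pow_zero by blast
  next
    case (Suc n)
    note outer = Suc.IH
    show ?case using Suc.prems
    proof (induction d arbitrary: g)
      case (Suc d)
      have "\<exists>h\<in>V (Suc e - Suc (Suc d)). (E ^^ Suc (Suc d)) h = E g"
        using Suc.prems E_V by (intro outer) auto
      then obtain h where h: "h \<in> V (e - Suc d)" "E ((E ^^ Suc d) h) = E g"
        by auto
      define g' where "g' = g - (E ^^ Suc d) h"
      have "(E ^^ Suc d) h \<in> V e"
        using E_pow_V[OF h(1), of "Suc d"] Suc.prems(3) by simp
      then have g': "g' \<in> V e" "E g' = 0"
        using subspace_diff[OF subspace_V] Suc.prems(2) h(2) unfolding g'_def
        by (auto simp: E.diff)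
      obtain h' where h': "h' \<in> V (e - d)" "(E ^^ d) h' = g'"
        using Suc.IH[OF Suc.prems(1) g'(1)] Suc.prems by auto
      let ?c = "(int d + 1) * (s - 2 * int (e - d) - int d)"
      \<comment> \<open>The second factor of the scalar is s - 2 e + d, which the bound on
        \<open>s\<close> makes at most -1.\<close>
      have c: "(of_int ?c :: 'k) \<noteq> 0"
        unfolding of_int_eq_0_iff using Suc.prems(3,4) by auto
      have "(E ^^ Suc d) h' = 0" using h'(2) g'(2) by simp
      then have *: "(E ^^ Suc d) (F h') + of_int ?c *s g' = 0"
        using F_E_pow[OF h'(1), of d] unfolding h'(2) by (simp only: F.zero)
      have Fh: "F h' \<in> V (e - Suc d)"
        using F_V[of h' "e - Suc d"] h'(1) Suc.prems(3) by (simp add: Suc_diff_Suc)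
      have "of_int ?c *s g' = - (E ^^ Suc d) (F h')"
        using * by (simp only: eq_neg_iff_add_eq_0 add.commute)
      then have "g' = (- inverse (of_int ?c)) *s (E ^^ Suc d) (F h')"
        using c by (metis scale_minus_left scale_minus_right scale_scale
            left_inverse scale_one)
      then have "(E ^^ Suc d) (h + (- inverse (of_int ?c)) *s F h') = g"
        unfolding E_pow_add E_pow_scale g'_def by (simp only: add_diff_cancel_left' diff_eq_eq add.commute)
      moreover have "h + (- inverse (of_int ?c)) *s F h' \<in> V (e - Suc d)"
        using h(1) Fh subspace_add subspace_scale subspace_V by meson
      ultimately show ?case by blast
    qed auto
  qed
  from this[of e "Suc N"] assms show ?thesis by simp
qed

end


section \<open>Maximal rank on quotients of monomial ideals\<close>

definition lin :: "'k::comm_ring_1 poly3" where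
  "lin = mon 1 0 0 + mon 0 1 0 + mon 0 0 1"

text \<open>The polynomials supported in an up-set of exponents form an ideal, so up-sets encode
  monomial ideals.\<close>

definition upset :: "'a::plus set \<Rightarrow> bool" where
  "upset P \<longleftrightarrow> (\<forall>m\<in>P. \<forall>n. m + n \<in> P)"

text \<open>For up-sets \<open>P \<subseteq> Q\<close>, the next two predicates say that multiplication by
  \<^term>\<open>lin ^ d\<close> is injective resp. surjective from degree \<open>i\<close> to degree \<open>i + d\<close> on the
  quotient of the monomial ideal spanned by \<open>Q\<close> by the one spanned by \<open>P\<close>.\<close>

definition inj_at :: "'k::comm_ring_1 itself \<Rightarrow> nat \<Rightarrow> nat \<Rightarrow> (nat \<times> nat \<times> nat) set \<Rightarrow>
    (nat \<times> nat \<times> nat) set \<Rightarrow> bool" where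
  "inj_at T i d Q P \<longleftrightarrow> (\<forall>f :: 'k poly3. homog i f \<longrightarrow> Poly_Mapping.keys f \<subseteq> Q \<longrightarrow>
     Poly_Mapping.keys (lin ^ d * f) \<subseteq> P \<longrightarrow> Poly_Mapping.keys f \<subseteq> P)"

definition surj_at :: "'k::comm_ring_1 itself \<Rightarrow> nat \<Rightarrow> nat \<Rightarrow> (nat \<times> nat \<times> nat) set \<Rightarrow>
    (nat \<times> nat \<times> nat) set \<Rightarrow> bool" where
  "surj_at T i d Q P \<longleftrightarrow> (\<forall>g :: 'k poly3. homog (i + d) g \<longrightarrow> Poly_Mapping.keys g \<subseteq> Q \<longrightarrow>
     (\<exists>f. homog i f \<and> Poly_Mapping.keys f \<subseteq> Q \<and> Poly_Mapping.keys (g - lin ^ d * f) \<subseteq> P))"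

section \<open>Coefficients, degrees and supports of products\<close>

lemma lookup_mon_times:
  "Poly_Mapping.lookup (mon a b c * f) (i, j, l) =
    (if a \<le> i \<and> b \<le> j \<and> c \<le> l then Poly_Mapping.lookup f (i - a, j - b, l - c) else 0)"
proof -
  have "Poly_Mapping.lookup (mon a b c * f) (i, j, l) =
      (\<Sum>q. Poly_Mapping.lookup f q when (i, j, l) = (a, b, c) + q)"
    by (simp add: mon_def lookup_mult lookup_single when_mult)
  also have "\<dots> = (\<Sum>q. (if a \<le> i \<and> b \<le> j \<and> c \<le> l then Poly_Mapping.lookup f q else 0)
      when q = (i - a, j - b, l - c))"
    by (intro arg_cong[of _ _ Sum_any] ext) (auto simp: when_def)
  finally show ?thesis by simp
qed

lemma lookup_lin_times:
  "Poly_Mapping.lookup (lin * f) (i, j, l) =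
    (if 0 < i then Poly_Mapping.lookup f (i - 1, j, l) else 0)
    + (if 0 < j then Poly_Mapping.lookup f (i, j - 1, l) else 0)
    + (if 0 < l then Poly_Mapping.lookup f (i, j, l - 1) else 0)"
  by (simp add: lin_def distrib_right lookup_add lookup_mon_times)

lemma keys_lin: "Poly_Mapping.keys lin \<subseteq> {m. tdeg m = 1}"
  by (clarsimp simp: in_keys_iff lin_def mon_def lookup_add lookup_single tdeg_def when_def
      split: if_splits)

lemma tdeg_plus: "tdeg (m + n) = tdeg m + tdeg n"
  by (auto simp: tdeg_def split: prod.splits)

lemma homog_lin: "homog 1 lin"
  using keys_lin by (auto simp: homog_def)

lemma homog_mult:
  assumes "homog d f" "homog e g"
  shows "homog (d + e) (f * g)"
  unfolding homog_def
proof
  fix m assume "m \<in> Poly_Mapping.keys (f * g)"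
  then obtain a b where "m = a + b" "a \<in> Poly_Mapping.keys f" "b \<in> Poly_Mapping.keys g"
    using keys_mult[of f g] by blast
  then show "tdeg m = d + e" using assms by (simp add: homog_def tdeg_plus)
qed

lemma homog_lin_pow_times: "homog i f \<Longrightarrow> homog (i + d) (lin ^ d * f)"
proof (induction d)
  case (Suc d)
  then show ?case using homog_mult[OF homog_lin, of "i + d" "lin ^ d * f"]
    by (simp add: mult.assoc)
qed simp

lemma homog_add: "homog d f \<Longrightarrow> homog d g \<Longrightarrow> homog d (f + g)"
  using keys_add[of f g] by (auto simp: homog_def)

lemma keys_diff_subset:
  "Poly_Mapping.keys f \<subseteq> P \<Longrightarrow> Poly_Mapping.keys g \<subseteq> P \<Longrightarrow> Poly_Mapping.keys (f - g) \<subseteq> P"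
  for f g :: "'a \<Rightarrow>\<^sub>0 'b::ab_group_add"
  by (simp add: in_keys_iff lookup_minus subset_iff) (metis diff_self)

lemma homog_diff: "homog d f \<Longrightarrow> homog d g \<Longrightarrow> homog d (f - g)"
  for f g :: "'k::ab_group_add poly3"
  using keys_diff_subset[of f "{m. tdeg m = d}" g] by (auto simp: homog_def)

lemma keys_mult_upset:
  "upset P \<Longrightarrow> Poly_Mapping.keys f \<subseteq> P \<Longrightarrow> Poly_Mapping.keys (g * f) \<subseteq> P"
  for f g :: "'a::comm_monoid_add \<Rightarrow>\<^sub>0 'b::comm_ring_1"
  using keys_mult[of g f] by (fastforce simp: upset_def add.commute)

text \<open>A polynomial sent into \<open>P\<close> is sent into \<open>R\<close>, so the first
  hypothesis puts it in \<open>R\<close>, where the second applies.\<close>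

lemma inj_at_chain:
  assumes "inj_at T i d Q R" "inj_at T i d R P" "P \<subseteq> R"
  shows "inj_at T i d Q P"
  using assms unfolding inj_at_def by blast

text \<open>A preimage modulo \<open>R\<close> leaves an error supported in \<open>R\<close>; a
  preimage of that error modulo \<open>P\<close> corrects it.\<close>

lemma surj_at_chain:
  fixes T :: "'k::comm_ring_1 itself"
  assumes "R \<subseteq> Q" "surj_at T i d Q R" "surj_at T i d R P"
  shows "surj_at T i d Q P"
  unfolding surj_at_def
proof (intro allI impI)
  fix g :: "'k poly3"
  assume g: "homog (i + d) g" "Poly_Mapping.keys g \<subseteq> Q"
  obtain f1 where f1: "homog i f1" "Poly_Mapping.keys f1 \<subseteq> Q"
    "Poly_Mapping.keys (g - lin ^ d * f1) \<subseteq> R"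
    using assms(2) g unfolding surj_at_def by blast
  have "homog (i + d) (g - lin ^ d * f1)"
    using g f1 homog_diff homog_lin_pow_times by blast
  then obtain f2 where f2: "homog i f2" "Poly_Mapping.keys f2 \<subseteq> R"
    "Poly_Mapping.keys (g - lin ^ d * f1 - lin ^ d * f2) \<subseteq> P"
    using assms(3) f1(3) unfolding surj_at_def by blast
  have "g - lin ^ d * f1 - lin ^ d * f2 = g - lin ^ d * (f1 + f2)"
    by (simp add: algebra_simps)
  moreover have "Poly_Mapping.keys (f1 + f2) \<subseteq> Q"
    using keys_add[of f1 f2] f1(2) f2(2) assms(1) by blast
  ultimately show "\<exists>f. homog i f \<and> Poly_Mapping.keys f \<subseteq> Q \<and> Poly_Mapping.keys (g - lin ^ d * f) \<subseteq> P"
    using homog_add[OF f1(1) f2(1)] f2(3) by metis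
qed

text \<open>Inclusion maps the quotient of \<open>Q'\<close> by \<open>P\<close> into that of
  \<open>Q\<close> by \<open>R\<close>, injectively because
  \<open>R \<inter> Q' \<subseteq> P\<close>; injectivity of the multiplication is inherited along
  this embedding.\<close>

lemma inj_at_restrict:
  fixes T :: "'k::comm_ring_1 itself"
  assumes "inj_at T i d Q R" "Q' \<subseteq> Q" "P \<subseteq> R" "R \<inter> Q' \<subseteq> P"
  shows "inj_at T i d Q' P"
  unfolding inj_at_def
proof (intro allI impI)
  fix f :: "'k poly3"
  assume f: "homog i f" "Poly_Mapping.keys f \<subseteq> Q'" "Poly_Mapping.keys (lin ^ d * f) \<subseteq> P"
  then have "Poly_Mapping.keys f \<subseteq> Q" "Poly_Mapping.keys (lin ^ d * f) \<subseteq> R"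
    using assms(2,3) by simp_all
  then have "Poly_Mapping.keys f \<subseteq> R" using assms(1) f(1) unfolding inj_at_def by simp
  then show "Poly_Mapping.keys f \<subseteq> P" using f(2) assms(4) by blast
qed

section \<open>Boxes of monomials\<close>

type_synonym expo = "nat \<times> nat \<times> nat"

text \<open>In one variable, \<open>x^i \<mapsto> weight p q i * x^(i - 1)\<close> is the lowering operator of the
  irreducible sl2-representation with basis \<open>x^p, \<dots>, x^(q - 1)\<close>; its vanishing at both \<open>p\<close> and \<open>q\<close>
  makes all boundary terms disappear.\<close>

definition weight :: "nat \<Rightarrow> nat \<Rightarrow> nat \<Rightarrow> 'k::field_char_0" where
  "weight p q i = of_int ((int i - int p) * (int q - int i))"

lemma weight_ends [simp]: "weight p q p = 0" "weight p q q = 0"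
  by (simp_all add: weight_def)

text \<open>The increment is the scalar by which the one-variable commutator acts on x^i.\<close>

lemma weight_Suc: "weight p q (Suc i) = weight p q i + of_int (int p + int q - 1 - 2 * int i)"
  by (simp add: weight_def algebra_simps)

text \<open>Vectors are arbitrary coefficient functions with pointwise addition; finite support is
  recovered later from membership in a \<open>deg_part\<close>.\<close>

definition fscale :: "'k::field_char_0 \<Rightarrow> (expo \<Rightarrow> 'k) \<Rightarrow> expo \<Rightarrow> 'k" where
  "fscale r \<phi> = (\<lambda>m. r * \<phi> m)"

lemma vector_space_fscale: "vector_space fscale"
  by unfold_locales (auto simp: fscale_def fun_eq_iff algebra_simps)

locale monomial_box =
  fixes p1 q1 p2 q2 p3 q3 :: nat and B :: "expo set"
  defines "B \<equiv> {p1..<q1} \<times> {p2..<q2} \<times> {p3..<q3}"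
begin

text \<open>Multiplication by x + y + z on coefficients, truncated to \<open>B\<close>; the guards
  prevent reading below the lower faces.\<close>

definition raise :: "(expo \<Rightarrow> 'k::field_char_0) \<Rightarrow> expo \<Rightarrow> 'k" where
  "raise \<phi> = (\<lambda>(i, j, l). if (i, j, l) \<in> B then
      (if p1 < i then \<phi> (i - 1, j, l) else 0) + (if p2 < j then \<phi> (i, j - 1, l) else 0)
      + (if p3 < l then \<phi> (i, j, l - 1) else 0) else 0)"

text \<open>The sum of the three one-variable lowering operators. At the upper faces the vanishing
  of \<open>weight\<close> takes the place of a guard.\<close>

definition lower :: "(expo \<Rightarrow> 'k::field_char_0) \<Rightarrow> expo \<Rightarrow> 'k" where
  "lower \<phi> = (\<lambda>(i, j, l). if (i, j, l) \<in> B then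
      weight p1 q1 (Suc i) * \<phi> (Suc i, j, l) + weight p2 q2 (Suc j) * \<phi> (i, Suc j, l)
      + weight p3 q3 (Suc l) * \<phi> (i, j, Suc l) else 0)"

definition deg_part :: "nat \<Rightarrow> (expo \<Rightarrow> 'k::field_char_0) set" where
  "deg_part d = {\<phi>. \<forall>m. \<phi> m \<noteq> 0 \<longrightarrow> m \<in> B \<and> tdeg m = d}"

lemma deg_part_iff:
  "\<phi> \<in> deg_part d \<longleftrightarrow> (\<forall>i j l. (i, j, l) \<notin> B \<or> i + j + l \<noteq> d \<longrightarrow> \<phi> (i, j, l) = 0)"
  by (auto simp: deg_part_def tdeg_def)

text \<open>For a nonempty box, the least degree plus the greatest one; each upper bound is
  exclusive, whence the 3.\<close>

definition center :: int where
  "center = int (p1 + q1 + p2 + q2 + p3 + q3) - 3"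

lemma raise_add: "raise (\<phi> + \<psi>) = raise \<phi> + raise \<psi>"
  and lower_add: "lower (\<phi> + \<psi>) = lower \<phi> + lower \<psi>"
  by (simp_all add: raise_def lower_def fun_eq_iff distrib_left)

lemma raise_fscale: "raise (fscale r \<phi>) = fscale r (raise \<phi>)"
  and lower_fscale: "lower (fscale r \<phi>) = fscale r (lower \<phi>)"
  by (simp_all add: raise_def lower_def fscale_def fun_eq_iff distrib_left mult.left_commute)

text \<open>Operators in different variables commute, so only the three one-variable commutators
  remain, and their scalars add up.\<close>

lemma lower_raise:
  fixes \<phi> :: "expo \<Rightarrow> 'k::field_char_0"
  assumes "\<phi> \<in> deg_part d"
  shows "lower (raise \<phi>) = raise (lower \<phi>) + fscale (of_int (center - 2 * int d)) \<phi>"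
proof
  fix m :: expo
  obtain i j l where m: "m = (i, j, l)" by (cases m)
  show "lower (raise \<phi>) m = (raise (lower \<phi>) + fscale (of_int (center - 2 * int d)) \<phi>) m"
  proof (cases "m \<in> B")
    case False
    then show ?thesis using assms
      by (auto simp: lower_def raise_def fscale_def deg_part_def m)
  next
    case True
    then have ijl: "p1 \<le> i" "i < q1" "p2 \<le> j" "j < q2" "p3 \<le> l" "l < q3"
      by (auto simp: B_def m)
    \<comment> \<open>At \<open>Suc i = q1\<close> the truncated value is 0 while the bracket need
      not be; the factor \<open>weight\<close> vanishes there. Dually, equations 4 to 6 use its
      vanishing at the lower faces.\<close>
    have 1: "weight p1 q1 (Suc i) * raise \<phi> (Suc i, j, l) = weight p1 q1 (Suc i) *
       (\<phi> (i, j, l) + (if p2 < j then \<phi> (Suc i, j - 1, l) else 0)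
         + (if p3 < l then \<phi> (Suc i, j, l - 1) else 0))"
      using ijl by (cases "Suc i = q1") (auto simp: raise_def B_def)
    have 2: "weight p2 q2 (Suc j) * raise \<phi> (i, Suc j, l) = weight p2 q2 (Suc j) *
       ((if p1 < i then \<phi> (i - 1, Suc j, l) else 0) + \<phi> (i, j, l)
         + (if p3 < l then \<phi> (i, Suc j, l - 1) else 0))"
      using ijl by (cases "Suc j = q2") (auto simp: raise_def B_def)
    have 3: "weight p3 q3 (Suc l) * raise \<phi> (i, j, Suc l) = weight p3 q3 (Suc l) *
       ((if p1 < i then \<phi> (i - 1, j, Suc l) else 0)
         + (if p2 < j then \<phi> (i, j - 1, Suc l) else 0) + \<phi> (i, j, l))"
      using ijl by (cases "Suc l = q3") (auto simp: raise_def B_def)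
    have 4: "(if p1 < i then lower \<phi> (i - 1, j, l) else 0) = weight p1 q1 i * \<phi> (i, j, l)
       + (if p1 < i then weight p2 q2 (Suc j) * \<phi> (i - 1, Suc j, l)
         + weight p3 q3 (Suc l) * \<phi> (i - 1, j, Suc l) else 0)"
      using ijl by (cases "p1 = i") (auto simp: lower_def B_def)
    have 5: "(if p2 < j then lower \<phi> (i, j - 1, l) else 0) = weight p2 q2 j * \<phi> (i, j, l)
       + (if p2 < j then weight p1 q1 (Suc i) * \<phi> (Suc i, j - 1, l)
         + weight p3 q3 (Suc l) * \<phi> (i, j - 1, Suc l) else 0)"
      using ijl by (cases "p2 = j") (auto simp: lower_def B_def)
    have 6: "(if p3 < l then lower \<phi> (i, j, l - 1) else 0) = weight p3 q3 l * \<phi> (i, j, l)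
       + (if p3 < l then weight p1 q1 (Suc i) * \<phi> (Suc i, j, l - 1)
         + weight p2 q2 (Suc j) * \<phi> (i, Suc j, l - 1) else 0)"
      using ijl by (cases "p3 = l") (auto simp: lower_def B_def)
    have "lower (raise \<phi>) m = raise (lower \<phi>) m +
      ((weight p1 q1 (Suc i) - weight p1 q1 i) + (weight p2 q2 (Suc j) - weight p2 q2 j)
        + (weight p3 q3 (Suc l) - weight p3 q3 l)) * \<phi> m"
      using True unfolding m lower_def[of "raise \<phi>"] raise_def[of "lower \<phi>"] prod.case
      by (simp add: 1 2 3 4 5 6 algebra_simps)
    also have "\<dots> = raise (lower \<phi>) m + of_int (center - 2 * int (tdeg m)) * \<phi> m"
      by (simp add: weight_Suc center_def tdeg_def m algebra_simps)
    also have "\<dots> = raise (lower \<phi>) m + of_int (center - 2 * int d) * \<phi> m"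
      using assms by (cases "\<phi> m = 0") (auto simp: deg_part_def m)
    finally show ?thesis by (simp add: fscale_def)
  qed
qed

lemma graded_sl2_box:
  "graded_sl2 (fscale :: 'k::field_char_0 \<Rightarrow> _) deg_part raise lower center (q1 + q2 + q3)"
proof -
  interpret vector_space "fscale :: 'k \<Rightarrow> _" by (rule vector_space_fscale)
  show ?thesis
  proof
    fix v :: "expo \<Rightarrow> 'k" and i
    show "subspace (deg_part i)"
      by (rule subspaceI) (auto simp: deg_part_def fscale_def; metis add_0_right add_0_left)+
    show "v \<in> deg_part i \<Longrightarrow> q1 + q2 + q3 < i \<Longrightarrow> v = 0"
      by (force simp: deg_part_def fun_eq_iff B_def tdeg_def)
    show "raise v \<in> deg_part (Suc i)" if v: "v \<in> deg_part i"
      unfolding deg_part_iff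
    proof (intro allI impI)
      fix a b c
      assume *: "(a, b, c) \<notin> B \<or> a + b + c \<noteq> Suc i"
      show "raise v (a, b, c) = 0"
      proof (cases "(a, b, c) \<in> B")
        case True
        have zero: "v (a', b', c') = 0" if "Suc (a' + b' + c') = a + b + c" for a' b' c'
        proof -
          have "a' + b' + c' \<noteq> i" using that * True by linarith
          then show ?thesis using v unfolding deg_part_iff by blast
        qed
        have "p1 < a \<Longrightarrow> v (a - 1, b, c) = 0" "p2 < b \<Longrightarrow> v (a, b - 1, c) = 0"
          "p3 < c \<Longrightarrow> v (a, b, c - 1) = 0"
          by (rule zero; linarith)+
        then show ?thesis by (simp add: raise_def)
      qed (simp add: raise_def)
    qed
    show "lower v \<in> deg_part i" if "v \<in> deg_part (Suc i)"
      using that unfolding deg_part_iff lower_def by simp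
    show "lower v = 0" if "v \<in> deg_part 0"
      using that unfolding deg_part_iff lower_def fun_eq_iff by simp
  qed (rule raise_add raise_fscale lower_add lower_fscale lower_raise; assumption?)+
qed

text \<open>When \<open>B = Q - P\<close>, this identifies the quotient of the ideal of
  \<open>Q\<close> by that of \<open>P\<close> with functions on the box.\<close>

definition proj :: "'k::field_char_0 poly3 \<Rightarrow> expo \<Rightarrow> 'k" where
  "proj f = (\<lambda>m. if m \<in> B then Poly_Mapping.lookup f m else 0)"

text \<open>Truncation loses nothing: a neighbour below a point of \<open>B\<close> but outside
  \<open>B\<close> cannot lie in the up-set \<open>P\<close>, hence is outside \<open>Q\<close>,
  where \<open>f\<close> has coefficient 0.\<close>

lemma proj_lin_times:
  assumes "Q - P = B" "upset P" "Poly_Mapping.keys f \<subseteq> Q"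
  shows "proj (lin * f) = raise (proj f)"
proof
  fix m :: expo
  obtain i j l where m: "m = (i, j, l)" by (cases m)
  have outside: "Poly_Mapping.lookup f n = 0" if "m \<in> B" "n \<notin> B" "m = n + e" for n e
    using that assms unfolding upset_def in_keys_iff subset_iff by blast
  show "proj (lin * f) m = raise (proj f) m"
  proof (cases "m \<in> B")
    case True
    then have ijl: "p1 \<le> i" "i < q1" "p2 \<le> j" "j < q2" "p3 \<le> l" "l < q3"
      by (auto simp: B_def m)
    have "(if 0 < i then Poly_Mapping.lookup f (i - 1, j, l) else 0)
        = (if p1 < i then proj f (i - 1, j, l) else 0)"
      using outside[OF True, of "(i - 1, j, l)" "(1, 0, 0)"] ijl
      by (auto simp: proj_def m B_def)
    moreover have "(if 0 < j then Poly_Mapping.lookup f (i, j - 1, l) else 0)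
        = (if p2 < j then proj f (i, j - 1, l) else 0)"
      using outside[OF True, of "(i, j - 1, l)" "(0, 1, 0)"] ijl
      by (auto simp: proj_def m B_def)
    moreover have "(if 0 < l then Poly_Mapping.lookup f (i, j, l - 1) else 0)
        = (if p3 < l then proj f (i, j, l - 1) else 0)"
      using outside[OF True, of "(i, j, l - 1)" "(0, 0, 1)"] ijl
      by (auto simp: proj_def m B_def)
    ultimately show ?thesis
      using True by (simp add: m proj_def[of "lin * f"] raise_def lookup_lin_times)
  qed (simp add: proj_def raise_def m)
qed

lemma proj_lin_pow_times:
  assumes "Q - P = B" "upset P" "upset Q" "Poly_Mapping.keys f \<subseteq> Q"
  shows "proj (lin ^ d * f) = (raise ^^ d) (proj f)"
proof (induction d)
  case (Suc d)
  have "proj (lin * (lin ^ d * f)) = raise (proj (lin ^ d * f))"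
    using assms keys_mult_upset by (intro proj_lin_times) blast+
  then show ?case using Suc by (simp add: mult.assoc)
qed simp

lemma proj_deg_part: "homog d f \<Longrightarrow> proj f \<in> deg_part d"
  by (auto simp: homog_def proj_def deg_part_def in_keys_iff split: if_splits)

lemma proj_eq_0_iff:
  assumes "Q - P = B" "Poly_Mapping.keys f \<subseteq> Q"
  shows "proj f = 0 \<longleftrightarrow> Poly_Mapping.keys f \<subseteq> P"
proof -
  have "proj f = 0 \<longleftrightarrow> (\<forall>m\<in>B. m \<notin> Poly_Mapping.keys f)"
    by (auto simp: proj_def fun_eq_iff in_keys_iff)
  then show ?thesis using assms by blast
qed

lemma inj_at_box:
  assumes "Q - P = B" "upset P" "upset Q" "2 * int i + int d \<le> center"
  shows "inj_at TYPE('k::field_char_0) i d Q P"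
  unfolding inj_at_def
proof (intro allI impI)
  fix f :: "'k poly3"
  assume f: "homog i f" "Poly_Mapping.keys f \<subseteq> Q" "Poly_Mapping.keys (lin ^ d * f) \<subseteq> P"
  have "(raise ^^ d) (proj f) = 0"
    using f assms proj_lin_pow_times proj_eq_0_iff keys_mult_upset by metis
  then have "proj f = 0"
    using graded_sl2.E_pow_inj[OF graded_sl2_box proj_deg_part] f(1) assms(4) by metis
  then show "Poly_Mapping.keys f \<subseteq> P" using proj_eq_0_iff assms f by metis
qed

lemma surj_at_box:
  assumes "Q - P = B" "upset P" "upset Q" "center \<le> 2 * int i + int d"
  shows "surj_at TYPE('k::field_char_0) i d Q P"
  unfolding surj_at_def
proof (intro allI impI)
  fix g :: "'k poly3"
  assume g: "homog (i + d) g" "Poly_Mapping.keys g \<subseteq> Q"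
  obtain \<phi> where \<phi>: "\<phi> \<in> deg_part i" "(raise ^^ d) \<phi> = proj g"
    using graded_sl2.E_pow_surj[OF graded_sl2_box proj_deg_part[OF g(1)], of d] assms(4)
    by auto
  \<comment> \<open>\<open>\<phi>\<close> is supported in the finite box, so it is the coefficient
    function of a polynomial.\<close>
  define f where "f = Abs_poly_mapping \<phi>"
  have "finite B" by (simp add: B_def)
  then have "finite {m. \<phi> m \<noteq> 0}"
    using \<phi>(1) by (rule_tac finite_subset[of _ B]) (auto simp: deg_part_def)
  then have lookup_f: "Poly_Mapping.lookup f = \<phi>" by (simp add: f_def)
  have f: "homog i f" "Poly_Mapping.keys f \<subseteq> Q" "proj f = \<phi>"
    using \<phi>(1) assms(1) lookup_f
    by (auto simp: homog_def in_keys_iff deg_part_def proj_def fun_eq_iff)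
  have "proj (g - lin ^ d * f) = proj g - proj (lin ^ d * f)"
    by (auto simp: proj_def fun_eq_iff lookup_minus)
  also have "\<dots> = 0"
    using proj_lin_pow_times[OF assms(1-3) f(2)] f(3) \<phi>(2) by simp
  finally have "Poly_Mapping.keys (g - lin ^ d * f) \<subseteq> P"
    using proj_eq_0_iff[OF assms(1)] keys_diff_subset[OF g(2)] keys_mult_upset[OF assms(3) f(2)]
    by blast
  then show "\<exists>f. homog i f \<and> Poly_Mapping.keys f \<subseteq> Q \<and> Poly_Mapping.keys (g - lin ^ d * f) \<subseteq> P"
    using f by blast
qed

end

text \<open>The box criteria in natural numbers, with the 3 of \<open>center\<close> moved across to
  avoid truncated subtraction.\<close>

lemma
  assumes "Q - P = {p1..<q1} \<times> {p2..<q2} \<times> {p3..<q3}" "upset P" "upset Q"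
  shows inj_at_box: "2 * i + d + 3 \<le> p1 + q1 + p2 + q2 + p3 + q3 \<Longrightarrow>
      inj_at TYPE('k::field_char_0) i d Q P"
    and surj_at_box: "p1 + q1 + p2 + q2 + p3 + q3 \<le> 2 * i + d + 3 \<Longrightarrow>
      surj_at TYPE('k::field_char_0) i d Q P"
proof -
  interpret monomial_box p1 q1 p2 q2 p3 q3 "{p1..<q1} \<times> {p2..<q2} \<times> {p3..<q3}"
    by (unfold_locales; simp)
  show "2 * i + d + 3 \<le> p1 + q1 + p2 + q2 + p3 + q3 \<Longrightarrow>
      inj_at TYPE('k::field_char_0) i d Q P"
    using assms by (intro inj_at_box) (auto simp: center_def)
  show "p1 + q1 + p2 + q2 + p3 + q3 \<le> 2 * i + d + 3 \<Longrightarrow>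
      surj_at TYPE('k::field_char_0) i d Q P"
    using assms by (intro surj_at_box) (auto simp: center_def)
qed

section \<open>Monomial ideals\<close>

lemma gen_ideal_0: "0 \<in> gen_ideal G"
  unfolding gen_ideal_def by (auto intro: exI[of _ "{}"])

lemma gen_ideal_mult: "g \<in> G \<Longrightarrow> r * g \<in> gen_ideal G"
  unfolding gen_ideal_def by (auto intro!: exI[of _ "{g}"] exI[of _ "\<lambda>_. r"])

lemma gen_ideal_add:
  assumes "x \<in> gen_ideal G" "y \<in> gen_ideal G"
  shows "x + y \<in> gen_ideal G"
proof -
  obtain G1 h1 where 1: "finite G1" "G1 \<subseteq> G" "x = (\<Sum>g\<in>G1. h1 g * g)"
    using assms(1) unfolding gen_ideal_def by blast
  obtain G2 h2 where 2: "finite G2" "G2 \<subseteq> G" "y = (\<Sum>g\<in>G2. h2 g * g)"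
    using assms(2) unfolding gen_ideal_def by blast
  \<comment> \<open>Both coefficient families are extended by zero to the union of the generator
    sets.\<close>
  have "x = (\<Sum>g\<in>G1 \<union> G2. (if g \<in> G1 then h1 g else 0) * g)"
    unfolding 1(3) using 1 2 by (intro sum.mono_neutral_cong_left) auto
  moreover have "y = (\<Sum>g\<in>G1 \<union> G2. (if g \<in> G2 then h2 g else 0) * g)"
    unfolding 2(3) using 1 2 by (intro sum.mono_neutral_cong_left) auto
  ultimately have "x + y =
      (\<Sum>g\<in>G1 \<union> G2. ((if g \<in> G1 then h1 g else 0) + (if g \<in> G2 then h2 g else 0)) * g)"
    by (simp only: distrib_right sum.distrib)
  moreover have "finite (G1 \<union> G2)" "G1 \<union> G2 \<subseteq> G" using 1 2 by auto
  ultimately show ?thesis unfolding gen_ideal_def mem_Collect_eq by (intro exI conjI)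
qed

lemma gen_ideal_sum: "(\<And>x. x \<in> A \<Longrightarrow> f x \<in> gen_ideal G) \<Longrightarrow> sum f A \<in> gen_ideal G"
  by (induction A rule: infinite_finite_induct) (auto intro: gen_ideal_0 gen_ideal_add)

lemma sum_monomials:
  "(\<Sum>m\<in>Poly_Mapping.keys f. Poly_Mapping.single m (Poly_Mapping.lookup f m)) = f"
proof (rule poly_mapping_eqI)
  fix k
  have "(\<Sum>m\<in>Poly_Mapping.keys f. Poly_Mapping.lookup f m when m = k) =
      (if k \<in> Poly_Mapping.keys f then Poly_Mapping.lookup f k else 0)"
    by (simp add: when_def)
  then show "Poly_Mapping.lookup (\<Sum>m\<in>Poly_Mapping.keys f.
      Poly_Mapping.single m (Poly_Mapping.lookup f m)) k = Poly_Mapping.lookup f k"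
    by (simp add: lookup_sum lookup_single in_keys_iff)
qed

text \<open>Multiples of a generator are supported in the up-set generated by \<open>M\<close>;
  conversely, each term of a polynomial supported there is a multiple of a generator.\<close>

lemma gen_ideal_monomials:
  fixes M :: "'a::comm_monoid_add set"
  shows "gen_ideal ((\<lambda>m. Poly_Mapping.single m (1 :: 'b::comm_ring_1)) ` M) =
    {f. Poly_Mapping.keys f \<subseteq> {m + n | m n. m \<in> M}}" (is "?I = {f. _ \<subseteq> ?P}")
proof (intro equalityI subsetI)
  fix f assume "f \<in> ?I"
  then obtain G h where G: "G \<subseteq> (\<lambda>m. Poly_Mapping.single m 1) ` M" "f = (\<Sum>g\<in>G. h g * g)"
    unfolding gen_ideal_def by blast
  have "upset ?P" by (force simp: upset_def add.assoc)
  have "Poly_Mapping.keys (h g * g) \<subseteq> ?P" if g: "g \<in> G" for g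
  proof (rule keys_mult_upset[OF \<open>upset ?P\<close>])
    obtain m where m: "m \<in> M" "g = Poly_Mapping.single m 1" using G(1) g by blast
    have "m = m + 0" by simp
    then have "m \<in> ?P" using m(1) by blast
    then show "Poly_Mapping.keys g \<subseteq> ?P" by (simp add: m(2))
  qed
  then have "(\<Union>g\<in>G. Poly_Mapping.keys (h g * g)) \<subseteq> ?P" by blast
  then show "f \<in> {f. Poly_Mapping.keys f \<subseteq> ?P}"
    using keys_sum[of "\<lambda>g. h g * g" G] unfolding G(2) by blast
next
  fix f :: "'a \<Rightarrow>\<^sub>0 'b" assume f: "f \<in> {f. Poly_Mapping.keys f \<subseteq> ?P}"
  have "Poly_Mapping.single k (Poly_Mapping.lookup f k) \<in> ?I" if k: "k \<in> Poly_Mapping.keys f" for k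
  proof -
    obtain m n where mn: "k = m + n" "m \<in> M" using f k by blast
    have "Poly_Mapping.single k (Poly_Mapping.lookup f k) =
        Poly_Mapping.single n (Poly_Mapping.lookup f k) * Poly_Mapping.single m 1"
      by (simp add: mult_single mn(1) add.commute)
    then show ?thesis using mn(2) by (simp add: gen_ideal_mult)
  qed
  then have "(\<Sum>k\<in>Poly_Mapping.keys f. Poly_Mapping.single k (Poly_Mapping.lookup f k)) \<in> ?I"
    by (rule gen_ideal_sum)
  then show "f \<in> ?I" by (simp only: sum_monomials)
qed

text \<open>The single form x + y + z serves for all \<open>i\<close> and \<open>d\<close>;
  \<open>UNIV\<close> stands for the whole ring.\<close>

lemma SLP_monomialI:
  assumes "\<And>i d. 0 < d \<Longrightarrow> inj_at TYPE('k::field_char_0) i d UNIV P \<or> surj_at TYPE('k) i d UNIV P"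
  shows "SLP {f :: 'k poly3. Poly_Mapping.keys f \<subseteq> P}"
  unfolding SLP_def
proof (intro exI[of _ lin] conjI allI impI)
  fix d i :: nat assume "0 < d"
  from assms[OF this, of i]
  show "(\<forall>f :: 'k poly3. homog i f \<and> lin ^ d * f \<in> {f. Poly_Mapping.keys f \<subseteq> P} \<longrightarrow>
       f \<in> {f. Poly_Mapping.keys f \<subseteq> P}) \<or>
     (\<forall>g :: 'k poly3. homog (i + d) g \<longrightarrow>
       (\<exists>f. homog i f \<and> g - lin ^ d * f \<in> {f. Poly_Mapping.keys f \<subseteq> P}))"
  proof
    assume "inj_at TYPE('k) i d UNIV P"
    then show ?thesis unfolding inj_at_def by simp
  next
    assume "surj_at TYPE('k) i d UNIV P"
    then show ?thesis unfolding surj_at_def by simp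
  qed
qed (rule homog_lin)

section \<open>The ideal of the theorem\<close>

locale truncated_box =
  fixes a b c \<alpha> \<beta> \<gamma> :: nat
  assumes pos: "0 < \<alpha>" "\<alpha> < a" "0 < \<beta>" "\<beta> < b" "0 < \<gamma>" "\<gamma> < c"
begin

definition P :: "expo set" where
  "P = {(i, j, l). a \<le> i \<or> b \<le> j \<or> c \<le> l \<or> (\<alpha> \<le> i \<or> \<beta> \<le> j) \<and> \<gamma> \<le> l}"

definition low :: "expo set" where
  "low = {(i, j, l). a \<le> i \<or> b \<le> j \<or> \<gamma> \<le> l}"

text \<open>The height is a parameter because case (3) replaces \<open>c\<close> by a more
  convenient value.\<close>

definition corner :: "nat \<Rightarrow> expo set" where
  "corner n = {(i, j, l). \<alpha> \<le> i \<or> \<beta> \<le> j \<or> n \<le> l}"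

lemma upset_P: "upset P" and upset_low: "upset low" and upset_corner: "upset (corner n)"
  by (auto simp: upset_def P_def low_def corner_def)

lemma upset_UNIV: "upset (UNIV :: expo set)"
  by (simp add: upset_def)

lemma ideal_eq:
  "gen_ideal {mon a 0 0, mon 0 b 0, mon 0 0 c, mon \<alpha> 0 \<gamma>, mon 0 \<beta> \<gamma>} =
    {f :: 'k::comm_ring_1 poly3. Poly_Mapping.keys f \<subseteq> P}"
proof -
  let ?M = "{(a, 0, 0), (0, b, 0), (0, 0, c), (\<alpha>, 0, \<gamma>), (0, \<beta>, \<gamma>)} :: expo set"
  have shift: "(\<exists>n. (i, j, l) = (p, q, r) + n) \<longleftrightarrow> p \<le> i \<and> q \<le> j \<and> r \<le> l"
    for i j l p q r :: nat
    by (auto simp: le_iff_add)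
  have "(i, j, l) \<in> {m + n | m n. m \<in> ?M} \<longleftrightarrow> (i, j, l) \<in> P" for i j l
  proof -
    have "(i, j, l) \<in> {m + n | m n. m \<in> ?M} \<longleftrightarrow> (\<exists>m\<in>?M. \<exists>n. (i, j, l) = m + n)"
      by blast
    also have "\<dots> \<longleftrightarrow> (i, j, l) \<in> P"
      unfolding bex_simps ball_simps shift P_def by auto
    finally show ?thesis .
  qed
  then have "{m + n | m n. m \<in> ?M} = P" by (intro set_eqI) (simp only: split_paired_all)
  then show ?thesis
    using gen_ideal_monomials[of ?M, where ?'b = 'k] by (simp add: mon_def)
qed

section \<open>Boxes cutting up the complement of \<open>P\<close>\<close>

lemma low_box: "UNIV - low = {0..<a} \<times> {0..<b} \<times> {0..<\<gamma>}"
  by (auto simp: low_def)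

lemma corner_box: "UNIV - corner n = {0..<\<alpha>} \<times> {0..<\<beta>} \<times> {0..<n}"
  by (auto simp: corner_def)

lemma
  shows inj_at_low: "2 * i + d + 3 \<le> a + b + \<gamma> \<Longrightarrow> inj_at TYPE('k::field_char_0) i d UNIV low"
    and surj_at_low: "a + b + \<gamma> \<le> 2 * i + d + 3 \<Longrightarrow> surj_at TYPE('k) i d UNIV low"
    and inj_at_corner: "2 * i + d + 3 \<le> \<alpha> + \<beta> + n \<Longrightarrow> inj_at TYPE('k) i d UNIV (corner n)"
    and surj_at_corner: "\<alpha> + \<beta> + n \<le> 2 * i + d + 3 \<Longrightarrow> surj_at TYPE('k) i d UNIV (corner n)"
proof -
  note low = low_box upset_low upset_UNIV and corner = corner_box upset_corner upset_UNIV
  show "2 * i + d + 3 \<le> a + b + \<gamma> \<Longrightarrow> inj_at TYPE('k) i d UNIV low"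
    by (rule inj_at_box[OF low]) simp
  show "a + b + \<gamma> \<le> 2 * i + d + 3 \<Longrightarrow> surj_at TYPE('k) i d UNIV low"
    by (rule surj_at_box[OF low]) simp
  show "2 * i + d + 3 \<le> \<alpha> + \<beta> + n \<Longrightarrow> inj_at TYPE('k) i d UNIV (corner n)"
    by (rule inj_at_box[OF corner]) simp
  show "\<alpha> + \<beta> + n \<le> 2 * i + d + 3 \<Longrightarrow> surj_at TYPE('k) i d UNIV (corner n)"
    by (rule surj_at_box[OF corner]) simp
qed

lemma
  shows inj_at_top: "2 * i + d + 3 \<le> \<alpha> + \<beta> + \<gamma> + c \<Longrightarrow> inj_at TYPE('k::field_char_0) i d low P"
    and surj_at_top: "\<alpha> + \<beta> + \<gamma> + c \<le> 2 * i + d + 3 \<Longrightarrow> surj_at TYPE('k) i d low P"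
proof -
  have "low - P = {0..<\<alpha>} \<times> {0..<\<beta>} \<times> {\<gamma>..<c}"
    using pos by (auto simp: low_def P_def)
  note box = this upset_P upset_low
  show "2 * i + d + 3 \<le> \<alpha> + \<beta> + \<gamma> + c \<Longrightarrow> inj_at TYPE('k) i d low P"
    by (rule inj_at_box[OF box]) simp
  show "\<alpha> + \<beta> + \<gamma> + c \<le> 2 * i + d + 3 \<Longrightarrow> surj_at TYPE('k) i d low P"
    by (rule surj_at_box[OF box]) simp
qed

text \<open>The part of \<open>corner c\<close> outside \<open>P\<close> has height \<gamma> and an
  L-shaped base. It is cut here at x = \<alpha> into two boxes, whose thresholds are the two
  bounds.\<close>

lemma
  shows inj_at_side_x: "2 * i + d + 3 \<le> \<alpha> + a + b + \<gamma> \<Longrightarrow> 2 * i + d + 3 \<le> \<alpha> + \<beta> + b + \<gamma> \<Longrightarrow>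
      inj_at TYPE('k::field_char_0) i d (corner c) P"
    and surj_at_side_x: "\<alpha> + a + b + \<gamma> \<le> 2 * i + d + 3 \<Longrightarrow> \<alpha> + \<beta> + b + \<gamma> \<le> 2 * i + d + 3 \<Longrightarrow>
      surj_at TYPE('k) i d (corner c) P"
proof -
  let ?R = "P \<union> {(i, j, l). \<alpha> \<le> i}"
  have R: "upset ?R" "P \<subseteq> ?R" "?R \<subseteq> corner c"
    using pos by (auto simp: upset_def P_def corner_def)
  have "?R - P = {\<alpha>..<a} \<times> {0..<b} \<times> {0..<\<gamma>}"
    using pos by (auto simp: P_def)
  note box1 = this upset_P R(1)
  have "corner c - ?R = {0..<\<alpha>} \<times> {\<beta>..<b} \<times> {0..<\<gamma>}"
    using pos by (auto simp: P_def corner_def)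
  note box2 = this R(1) upset_corner
  show "inj_at TYPE('k) i d (corner c) P"
    if "2 * i + d + 3 \<le> \<alpha> + a + b + \<gamma>" "2 * i + d + 3 \<le> \<alpha> + \<beta> + b + \<gamma>"
    by (rule inj_at_chain[OF inj_at_box[OF box2] inj_at_box[OF box1] R(2)]; use that in simp)
  show "surj_at TYPE('k) i d (corner c) P"
    if "\<alpha> + a + b + \<gamma> \<le> 2 * i + d + 3" "\<alpha> + \<beta> + b + \<gamma> \<le> 2 * i + d + 3"
    by (rule surj_at_chain[OF R(3) surj_at_box[OF box2] surj_at_box[OF box1]];
        use that in simp)
qed

text \<open>The same L-shaped part cut at y = \<beta>, which yields other thresholds.\<close>

lemma
  shows inj_at_side_y: "2 * i + d + 3 \<le> \<beta> + a + b + \<gamma> \<Longrightarrow> 2 * i + d + 3 \<le> \<alpha> + \<beta> + a + \<gamma> \<Longrightarrow>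
      inj_at TYPE('k::field_char_0) i d (corner c) P"
    and surj_at_side_y: "\<beta> + a + b + \<gamma> \<le> 2 * i + d + 3 \<Longrightarrow> \<alpha> + \<beta> + a + \<gamma> \<le> 2 * i + d + 3 \<Longrightarrow>
      surj_at TYPE('k) i d (corner c) P"
proof -
  let ?R = "P \<union> {(i, j, l). \<beta> \<le> j}"
  have R: "upset ?R" "P \<subseteq> ?R" "?R \<subseteq> corner c"
    using pos by (auto simp: upset_def P_def corner_def)
  have "?R - P = {0..<a} \<times> {\<beta>..<b} \<times> {0..<\<gamma>}"
    using pos by (auto simp: P_def)
  note box1 = this upset_P R(1)
  have "corner c - ?R = {\<alpha>..<a} \<times> {0..<\<beta>} \<times> {0..<\<gamma>}"
    using pos by (auto simp: P_def corner_def)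
  note box2 = this R(1) upset_corner
  show "inj_at TYPE('k) i d (corner c) P"
    if "2 * i + d + 3 \<le> \<beta> + a + b + \<gamma>" "2 * i + d + 3 \<le> \<alpha> + \<beta> + a + \<gamma>"
    by (rule inj_at_chain[OF inj_at_box[OF box2] inj_at_box[OF box1] R(2)]; use that in simp)
  show "surj_at TYPE('k) i d (corner c) P"
    if "\<beta> + a + b + \<gamma> \<le> 2 * i + d + 3" "\<alpha> + \<beta> + a + \<gamma> \<le> 2 * i + d + 3"
    by (rule surj_at_chain[OF R(3) surj_at_box[OF box2] surj_at_box[OF box1]];
        use that in simp)
qed

section \<open>Maximal rank in the three cases\<close>

lemma P_subset_low: "P \<subseteq> low" and P_subset_corner: "P \<subseteq> corner c"
  using pos by (auto simp: P_def low_def corner_def)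

text \<open>The thresholds of the two boxes differ by at most one, so no integer lies strictly
  between them.\<close>

lemma rank_case1:
  assumes "a + b \<le> \<alpha> + \<beta> + c + 1" "\<alpha> + \<beta> + c \<le> a + b + 1"
  shows "inj_at TYPE('k::field_char_0) i d UNIV P \<or> surj_at TYPE('k) i d UNIV P"
proof -
  have "2 * i + d + 3 \<le> a + b + \<gamma> \<and> 2 * i + d + 3 \<le> \<alpha> + \<beta> + \<gamma> + c \<or>
      a + b + \<gamma> \<le> 2 * i + d + 3 \<and> \<alpha> + \<beta> + \<gamma> + c \<le> 2 * i + d + 3"
    using assms by linarith
  then show ?thesis
    using inj_at_chain[OF inj_at_low inj_at_top P_subset_low]
      surj_at_chain[OF subset_UNIV surj_at_low surj_at_top] by blast
qed

text \<open>If \<beta> = a, both side boxes of the cut at x = \<alpha> have the same threshold,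
  within one of that of the corner; if \<alpha> = b, the cut at y = \<beta> does this.\<close>

lemma rank_case2:
  assumes "\<beta> = a \<and> b + \<gamma> \<le> c + 1 \<and> c \<le> b + \<gamma> + 1 \<or> \<alpha> = b \<and> a + \<gamma> \<le> c + 1 \<and> c \<le> a + \<gamma> + 1"
  shows "inj_at TYPE('k::field_char_0) i d UNIV P \<or> surj_at TYPE('k) i d UNIV P"
  using assms
proof
  assume *: "\<beta> = a \<and> b + \<gamma> \<le> c + 1 \<and> c \<le> b + \<gamma> + 1"
  then have "2 * i + d + 3 \<le> \<alpha> + \<beta> + c \<and> 2 * i + d + 3 \<le> \<alpha> + a + b + \<gamma> \<or>
      \<alpha> + \<beta> + c \<le> 2 * i + d + 3 \<and> \<alpha> + a + b + \<gamma> \<le> 2 * i + d + 3"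
    by linarith
  then show ?thesis
    using * inj_at_chain[OF inj_at_corner inj_at_side_x P_subset_corner]
      surj_at_chain[OF subset_UNIV surj_at_corner surj_at_side_x] by blast
next
  assume *: "\<alpha> = b \<and> a + \<gamma> \<le> c + 1 \<and> c \<le> a + \<gamma> + 1"
  then have "2 * i + d + 3 \<le> \<alpha> + \<beta> + c \<and> 2 * i + d + 3 \<le> \<beta> + a + b + \<gamma> \<or>
      \<alpha> + \<beta> + c \<le> 2 * i + d + 3 \<and> \<beta> + a + b + \<gamma> \<le> 2 * i + d + 3"
    by linarith
  moreover have "\<alpha> + \<beta> + a + \<gamma> = \<beta> + a + b + \<gamma>" using * by simp
  ultimately show ?thesis
    using * inj_at_chain[OF inj_at_corner inj_at_side_y P_subset_corner]
      surj_at_chain[OF subset_UNIV surj_at_corner surj_at_side_y] by metis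
qed

text \<open>In degree \<open>e\<close> the z-exponent is at most \<open>e\<close>, so neither height
  is reached.\<close>

lemma keys_corner_cong:
  assumes "homog e f" "e < m" "e < n" "Poly_Mapping.keys f \<subseteq> corner m"
  shows "Poly_Mapping.keys f \<subseteq> corner n"
proof
  fix x assume x: "x \<in> Poly_Mapping.keys f"
  then have "tdeg x = e" "x \<in> corner m" using assms(1,4) by (auto simp: homog_def)
  then show "x \<in> corner n" using assms(2,3) by (auto simp: tdeg_def corner_def)
qed

text \<open>Below degree \<open>c\<close> the height of the corner box is irrelevant, so that the height
  \<open>2 * i + d\<close>, for which degrees \<open>i\<close> and \<open>i + d\<close> are symmetric, may be used instead.\<close>

lemma
  assumes "\<alpha> + \<beta> = 3" "0 < i" "i + d < c"
  shows inj_at_corner_low: "inj_at TYPE('k::field_char_0) i d UNIV (corner c)"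
    and surj_at_corner_low: "surj_at TYPE('k) i d UNIV (corner c)"
proof -
  \<comment> \<open>As \<alpha> + \<beta> = 3, this height turns both threshold inequalities into
    equalities; \<open>0 < i\<close> ensures \<open>i + d < ?n\<close>.\<close>
  let ?n = "2 * i + d"
  show "inj_at TYPE('k) i d UNIV (corner c)"
    unfolding inj_at_def
  proof (intro allI impI)
    fix f :: "'k poly3"
    assume f: "homog i f" "Poly_Mapping.keys (lin ^ d * f) \<subseteq> corner c"
    have "Poly_Mapping.keys (lin ^ d * f) \<subseteq> corner ?n"
      using keys_corner_cong[OF homog_lin_pow_times[OF f(1)], of d c ?n] f(2) assms by auto
    then have "Poly_Mapping.keys f \<subseteq> corner ?n"
      using inj_at_corner[of i d ?n, where ?'k = 'k] f(1) assms unfolding inj_at_def by auto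
    then show "Poly_Mapping.keys f \<subseteq> corner c"
      using keys_corner_cong[OF f(1), of ?n c] assms by auto
  qed
  show "surj_at TYPE('k) i d UNIV (corner c)"
    unfolding surj_at_def
  proof (intro allI impI)
    fix g :: "'k poly3"
    assume g: "homog (i + d) g"
    obtain f where f: "homog i f" "Poly_Mapping.keys (g - lin ^ d * f) \<subseteq> corner ?n"
      using surj_at_corner[of ?n i d, where ?'k = 'k] g assms unfolding surj_at_def by auto
    have "homog (i + d) (g - lin ^ d * f)"
      using g f(1) homog_diff homog_lin_pow_times by blast
    then have "Poly_Mapping.keys (g - lin ^ d * f) \<subseteq> corner c"
      by (rule keys_corner_cong) (use f(2) assms in auto)
    then show "\<exists>f. homog i f \<and> Poly_Mapping.keys f \<subseteq> UNIV \<and>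
        Poly_Mapping.keys (g - lin ^ d * f) \<subseteq> corner c"
      using f(1) by blast
  qed
qed

lemma rank_case3:
  assumes \<alpha>\<beta>: "\<alpha> = 1 \<and> \<beta> = 2 \<or> \<alpha> = 2 \<and> \<beta> = 1" and c: "a + b + \<gamma> \<le> c + 2"
  shows "inj_at TYPE('k::field_char_0) i d UNIV P \<or> surj_at TYPE('k) i d UNIV P"
proof -
  have sum: "\<alpha> + \<beta> = 3" using \<alpha>\<beta> by auto
  \<comment> \<open>Outside \<open>P\<close>, a point of \<open>corner c\<close> has degree at most
    a + b + \<gamma> - 3, which is below \<open>c\<close>.\<close>
  have high: "m \<in> P" if "m \<in> corner c" "c \<le> tdeg m" for m
    using that c pos by (auto simp: P_def corner_def tdeg_def)
  consider "c \<le> i + d" | "i = 0" "i + d < c" | "0 < i" "i + d < c" "2 * i + d + 3 \<le> a + b + \<gamma>"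
    | "0 < i" "i + d < c" "a + b + \<gamma> \<le> 2 * i + d + 2"
    by linarith
  then show ?thesis
  proof cases
    case 1
    have "surj_at TYPE('k) i d UNIV (corner c)"
      using sum 1 by (intro surj_at_corner) simp
    moreover have "Poly_Mapping.keys g \<subseteq> P"
      if "homog (i + d) g" "Poly_Mapping.keys g \<subseteq> corner c" for g :: "'k poly3"
      using that high 1 by (auto simp: homog_def)
    ultimately show ?thesis
      unfolding surj_at_def using homog_diff homog_lin_pow_times by metis
  next
    case 2
    have "inj_at TYPE('k) i d UNIV (corner c)"
      using sum 2 by (intro inj_at_corner) simp
    \<comment> \<open>The origin is not in \<open>corner c\<close>, so such an \<open>f\<close> of
      degree 0 is zero.\<close>
    moreover have "Poly_Mapping.keys f \<subseteq> P"
      if "homog i f" "Poly_Mapping.keys f \<subseteq> corner c" for f :: "'k poly3"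
      using that 2 pos by (force simp: homog_def corner_def tdeg_def)
    ultimately show ?thesis
      using P_subset_corner unfolding inj_at_def by (meson subset_trans)
  next
    case 3
    have "low \<inter> corner c \<subseteq> P" using pos by (auto simp: low_def corner_def P_def)
    then have "inj_at TYPE('k) i d (corner c) P"
      using inj_at_restrict[OF inj_at_low subset_UNIV P_subset_low] 3 by blast
    then show ?thesis
      using inj_at_chain[OF inj_at_corner_low _ P_subset_corner] 3 sum by blast
  next
    case 4
    \<comment> \<open>Cutting at the variable whose exponent is 1 makes a + b + \<gamma> + 1 the
      larger threshold; the other one is no larger because a and b are at least 2.\<close>
    have "surj_at TYPE('k) i d (corner c) P"
      using \<alpha>\<beta>
    proof
      assume "\<alpha> = 1 \<and> \<beta> = 2"
      then show ?thesis using 4 pos by (intro surj_at_side_x) auto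
    next
      assume "\<alpha> = 2 \<and> \<beta> = 1"
      then show ?thesis using 4 pos by (intro surj_at_side_y) auto
    qed
    then show ?thesis
      using surj_at_chain[OF subset_UNIV surj_at_corner_low] 4 sum by blast
  qed
qed

end

theorem theorem4p1:
  fixes a b c \<alpha> \<beta> \<gamma> :: nat
  assumes "0 < \<alpha>" "\<alpha> < a" "0 < \<beta>" "\<beta> < b" "0 < \<gamma>" "\<gamma> < c"
  assumes "(int \<alpha> + int \<beta> - 1 \<le> int a + int b - int c \<and>
            int a + int b - int c \<le> int \<alpha> + int \<beta> + 1)
         \<or> (min \<alpha> \<beta> \<noteq> max \<alpha> \<beta> \<and> max \<alpha> \<beta> = min (\<alpha> + \<beta>) (min a b) \<and>
            int (max \<alpha> \<beta>) - int \<gamma> - 1 \<le> int a + int b - int c \<and>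
            int a + int b - int c \<le> int (max \<alpha> \<beta>) - int \<gamma> + 1)
         \<or> (min \<alpha> \<beta> < max \<alpha> \<beta> \<and> max \<alpha> \<beta> \<le> 2 \<and> a + b + \<gamma> \<le> c + 2)"
  shows "SLP (gen_ideal {mon a 0 0, mon 0 b 0, mon 0 0 c, mon \<alpha> 0 \<gamma>, mon 0 \<beta> \<gamma>}
               :: 'k::field_char_0 poly3 set)"
proof -
  interpret truncated_box a b c \<alpha> \<beta> \<gamma> by unfold_locales (fact assms)+
  have "(a + b \<le> \<alpha> + \<beta> + c + 1 \<and> \<alpha> + \<beta> + c \<le> a + b + 1)
    \<or> (\<beta> = a \<and> b + \<gamma> \<le> c + 1 \<and> c \<le> b + \<gamma> + 1 \<or> \<alpha> = b \<and> a + \<gamma> \<le> c + 1 \<and> c \<le> a + \<gamma> + 1)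
    \<or> ((\<alpha> = 1 \<and> \<beta> = 2 \<or> \<alpha> = 2 \<and> \<beta> = 1) \<and> a + b + \<gamma> \<le> c + 2)"
    using assms(7)
  proof (elim disjE conjE)
    assume "max \<alpha> \<beta> = min (\<alpha> + \<beta>) (min a b)" "min \<alpha> \<beta> \<noteq> max \<alpha> \<beta>"
      and *: "int (max \<alpha> \<beta>) - int \<gamma> - 1 \<le> int a + int b - int c"
        "int a + int b - int c \<le> int (max \<alpha> \<beta>) - int \<gamma> + 1"
    \<comment> \<open>By positivity the maximum is below \<alpha> + \<beta>, so it equals a or b;
      \<alpha> < a and \<beta> < b leave only these two options.\<close>
    then consider "max \<alpha> \<beta> = \<beta>" "\<beta> = a" | "max \<alpha> \<beta> = \<alpha>" "\<alpha> = b"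
      using assms(1-4) by (auto simp: min_def max_def split: if_splits)
    then show ?thesis
    proof cases
      case 1
      then show ?thesis using * by auto
    next
      case 2
      then show ?thesis using * by auto
    qed
  next
    assume "min \<alpha> \<beta> < max \<alpha> \<beta>" "max \<alpha> \<beta> \<le> 2" "a + b + \<gamma> \<le> c + 2"
    then show ?thesis using assms(1,3) by (auto simp: min_def max_def split: if_splits)
  qed linarith
  then have "inj_at TYPE('k) i d UNIV P \<or> surj_at TYPE('k) i d UNIV P" for i d
    using rank_case1 rank_case2 rank_case3 by blast
  then show ?thesis unfolding ideal_eq by (intro SLP_monomialI)
qed

end
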